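(* Both the (non-adaptive) greedy algorithm and the adaptive greedy algorithm are $\frac14\left(1-\frac1e\right)$-approximate to the optimal adaptive policy under the independent cascade model with myopic feedback. That is, for every influence graph $G=(V,E,p)$ and every budget $1\le k\le |V|$, $$\mathrm{Greedy}_N(G,k)\ge \tfrac14\left(1-\tfrac1e\right)\mathrm{OPT}_A(G,k)\quad\text{and}\quad \mathrm{Greedy}_A(G,k)\ge \tfrac14\left(1-\tfrac1e\right)\mathrm{OPT}_A(G,k).$$
   Context: Influence graph: $G=(V,E,p)$, where $V$ is a finite nonempty set of nodes, $E\subseteq V\times V$ is a set of directed edges, and each edge $(u,v)\in E$ carries a probability $p_{uv}\in[0,1]$. Independent cascade (IC) model: a random live-edge graph is obtained by declaring each edge $(u,v)\in E$ live independently with probability $p_{uv}$, and blocked otherwise. A realization $\phi$ specifies the status (live or blocked) of every edge; it is identified with the corresponding live-edge graph. $\mathcal P$ denotes the distribution of the random realization $\Phi$. For $S\subseteq V$, $\Gamma(S,\phi)$ is the set of nodes reachable in $\phi$ from nodes of $S$ (including $S$ itself), $f(S,\phi)=|\Gamma(S,\phi)|$, and $\sigma(S)=\mathbb E_{\Phi\sim\mathcal P}[f(S,\Phi)]$ is the influence spread of $S$. Myopic feedback: when $u$ is selected as a seed under realization $\phi$, the feedback $\phi(u)$ revealed is the live/blocked status of the out-going edges of $u$, and nothing else. A partial realization $\psi$ assigns to each node of a set $\mathrm{dom}(\psi)\subseteq V$ a status of its out-going edges; $\phi\sim\psi$ means $\phi(u)=\psi(u)$ for all $u\in\mathrm{dom}(\psi)$.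 A (deterministic) adaptive policy $\pi$ selects seeds one by one: starting from the empty partial realization, when the current partial realization is $\psi$ it either stops or selects a node $\pi(\psi)\notin\mathrm{dom}(\psi)$, and the pair $(\pi(\psi),\phi(\pi(\psi)))$ is then added to $\psi$. $V(\pi,\phi)$ is the set of nodes selected by $\pi$ under realization $\phi$. $\Pi(k)$ is the set of policies with $|V(\pi,\phi)|\le k$ for all $\phi$. The adaptive influence spread is $\sigma(\pi)=\mathbb E_{\Phi\sim\mathcal P}[f(V(\pi,\Phi),\Phi)]$, and $\mathrm{OPT}_A(G,k)=\max_{\pi\in\Pi(k)}\sigma(\pi)$. Marginal gains: $\Delta_f(u\mid S)=\sigma(S\cup\{u\})-\sigma(S)$ and $\Delta_f(u\mid\psi)=\mathbb E_{\Phi\sim\mathcal P}[f(\mathrm{dom}(\psi)\cup\{u\},\Phi)-f(\mathrm{dom}(\psi),\Phi)\mid\Phi\sim\psi]$. Greedy algorithm: start with $S=\emptyset$; while $|S|<k$ add to $S$ a node $u\in V\setminus S$ maximizing $\Delta_f(u\mid S)$; $\mathrm{Greedy}_N(G,k)=\sigma(S)$ for the final $S$. Adaptive greedy algorithm: the adaptive policy that selects $k$ seeds and, when the current partial realization is $\psi$ (with fewer than $k$ nodes selected), selects a node $u\in V\setminus\mathrm{dom}(\psi)$ maximizing $\Delta_f(u\mid\psi)$; $\mathrm{Greedy}_A(G,k)$ is its adaptive influence spread. Ties are broken arbitrarily (the claim holds for any tie-breaking). *)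

theory Defs
  imports "HOL-Probability.Probability" "HOL-Probability.Product_PMF"
begin

definition influence_graph :: "'a set \<Rightarrow> ('a \<times> 'a) set \<Rightarrow> ('a \<times> 'a \<Rightarrow> real) \<Rightarrow> bool" where
  "influence_graph V E p \<longleftrightarrow>
     finite V \<and> V \<noteq> {} \<and> E \<subseteq> V \<times> V \<and> (\<forall>e\<in>E. 0 \<le> p e \<and> p e \<le> 1)"

(* A realization maps each edge to True (live) or False (blocked). Values outside E are
   irrelevant: everything below depends on a realization only through live_edges. *)
type_synonym 'a realization = "'a \<times> 'a \<Rightarrow> bool"

definition realization_pmf ::
  "('a \<times> 'a) set \<Rightarrow> ('a \<times> 'a \<Rightarrow> real) \<Rightarrow> 'a realization pmf" where
  "realization_pmf E p = Pi_pmf E False (\<lambda>e. bernoulli_pmf (p e))"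

definition live_edges :: "('a \<times> 'a) set \<Rightarrow> 'a realization \<Rightarrow> ('a \<times> 'a) set" where
  "live_edges E \<phi> = {e \<in> E. \<phi> e}"

definition reached :: "('a \<times> 'a) set \<Rightarrow> 'a set \<Rightarrow> 'a realization \<Rightarrow> 'a set" where
  "reached E S \<phi> = (live_edges E \<phi>)\<^sup>* `` S"

definition cascade_size :: "('a \<times> 'a) set \<Rightarrow> 'a set \<Rightarrow> 'a realization \<Rightarrow> real" where
  "cascade_size E S \<phi> = real (card (reached E S \<phi>))"

definition spread :: "('a \<times> 'a) set \<Rightarrow> ('a \<times> 'a \<Rightarrow> real) \<Rightarrow> 'a set \<Rightarrow> real" where
  "spread E p S = measure_pmf.expectation (realization_pmf E p) (cascade_size E S)"

(* The status of all out-going edges of u is encoded by the set of heads of the live ones. *)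
definition feedback :: "('a \<times> 'a) set \<Rightarrow> 'a realization \<Rightarrow> 'a \<Rightarrow> 'a set" where
  "feedback E \<phi> u = live_edges E \<phi> `` {u}"

type_synonym 'a partial_realization = "'a \<rightharpoonup> 'a set"

definition is_partial_realization ::
  "'a set \<Rightarrow> ('a \<times> 'a) set \<Rightarrow> 'a partial_realization \<Rightarrow> bool" where
  "is_partial_realization V E \<psi> \<longleftrightarrow> (\<forall>u N. \<psi> u = Some N \<longrightarrow> u \<in> V \<and> N \<subseteq> E `` {u})"

definition consistent ::
  "('a \<times> 'a) set \<Rightarrow> 'a realization \<Rightarrow> 'a partial_realization \<Rightarrow> bool" where
  "consistent E \<phi> \<psi> \<longleftrightarrow> (\<forall>u\<in>dom \<psi>. \<psi> u = Some (feedback E \<phi> u))"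

(* None means that the policy stops. *)
type_synonym 'a policy = "'a partial_realization \<Rightarrow> 'a option"

definition is_policy :: "'a set \<Rightarrow> ('a \<times> 'a) set \<Rightarrow> 'a policy \<Rightarrow> bool" where
  "is_policy V E \<pi> \<longleftrightarrow>
     (\<forall>\<psi> u. is_partial_realization V E \<psi> \<longrightarrow> \<pi> \<psi> = Some u \<longrightarrow> u \<in> V - dom \<psi>)"

definition policy_step ::
  "('a \<times> 'a) set \<Rightarrow> 'a policy \<Rightarrow> 'a realization \<Rightarrow> 'a partial_realization \<Rightarrow> 'a partial_realization"
  where
  "policy_step E \<pi> \<phi> \<psi> =
     (case \<pi> \<psi> of None \<Rightarrow> \<psi> | Some u \<Rightarrow> \<psi>(u \<mapsto> feedback E \<phi> u))"

(* Once the policy stops, policy_step leaves the partial realization unchanged, so the union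
   over all numbers of steps is the domain of the final partial realization. *)
definition selected :: "('a \<times> 'a) set \<Rightarrow> 'a policy \<Rightarrow> 'a realization \<Rightarrow> 'a set" where
  "selected E \<pi> \<phi> = (\<Union>n. dom ((policy_step E \<pi> \<phi> ^^ n) Map.empty))"

definition policies :: "'a set \<Rightarrow> ('a \<times> 'a) set \<Rightarrow> nat \<Rightarrow> 'a policy set" where
  "policies V E k = {\<pi>. is_policy V E \<pi> \<and> (\<forall>\<phi>. card (selected E \<pi> \<phi>) \<le> k)}"

definition adaptive_spread ::
  "('a \<times> 'a) set \<Rightarrow> ('a \<times> 'a \<Rightarrow> real) \<Rightarrow> 'a policy \<Rightarrow> real" where
  "adaptive_spread E p \<pi> =
     measure_pmf.expectation (realization_pmf E p) (\<lambda>\<phi>. cascade_size E (selected E \<pi> \<phi>) \<phi>)"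

definition opt_adaptive ::
  "'a set \<Rightarrow> ('a \<times> 'a) set \<Rightarrow> ('a \<times> 'a \<Rightarrow> real) \<Rightarrow> nat \<Rightarrow> real" where
  "opt_adaptive V E p k = Max (adaptive_spread E p ` policies V E k)"

definition gain :: "('a \<times> 'a) set \<Rightarrow> ('a \<times> 'a \<Rightarrow> real) \<Rightarrow> 'a set \<Rightarrow> 'a \<Rightarrow> real" where
  "gain E p S u = spread E p (S \<union> {u}) - spread E p S"

(* Meaningful only if some realization of positive probability is consistent with \<psi>. *)
definition cond_gain ::
  "('a \<times> 'a) set \<Rightarrow> ('a \<times> 'a \<Rightarrow> real) \<Rightarrow> 'a partial_realization \<Rightarrow> 'a \<Rightarrow> real" where
  "cond_gain E p \<psi> u =
     measure_pmf.expectation (cond_pmf (realization_pmf E p) {\<phi>. consistent E \<phi> \<psi>})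
       (\<lambda>\<phi>. cascade_size E (dom \<psi> \<union> {u}) \<phi> - cascade_size E (dom \<psi>) \<phi>)"

(* The seed sets that can occur during a run of the greedy algorithm, for some tie-breaking. *)
inductive greedy_state ::
  "'a set \<Rightarrow> ('a \<times> 'a) set \<Rightarrow> ('a \<times> 'a \<Rightarrow> real) \<Rightarrow> nat \<Rightarrow> 'a set \<Rightarrow> bool"
  for V E p k where
  start: "greedy_state V E p k {}"
| add: "greedy_state V E p k S \<Longrightarrow> card S < k \<Longrightarrow>
        is_arg_max (gain E p S) (\<lambda>w. w \<in> V - S) u \<Longrightarrow> greedy_state V E p k (S \<union> {u})"

definition greedy_output ::
  "'a set \<Rightarrow> ('a \<times> 'a) set \<Rightarrow> ('a \<times> 'a \<Rightarrow> real) \<Rightarrow> nat \<Rightarrow> 'a set \<Rightarrow> bool" where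
  "greedy_output V E p k S \<longleftrightarrow> greedy_state V E p k S \<and> \<not> card S < k"

(* On partial realizations of probability zero the conditional gain is undefined, so there an
   arbitrary new node may be selected. *)
definition adaptive_greedy ::
  "'a set \<Rightarrow> ('a \<times> 'a) set \<Rightarrow> ('a \<times> 'a \<Rightarrow> real) \<Rightarrow> nat \<Rightarrow> 'a policy \<Rightarrow> bool" where
  "adaptive_greedy V E p k \<pi> \<longleftrightarrow>
     (\<forall>\<psi>. is_partial_realization V E \<psi> \<longrightarrow>
        (if card (dom \<psi>) < k
         then \<exists>u. \<pi> \<psi> = Some u \<and> u \<in> V - dom \<psi> \<and>
                (measure_pmf.prob (realization_pmf E p) {\<phi>. consistent E \<phi> \<psi>} > 0 \<longrightarrow>
                   is_arg_max (cond_gain E p \<psi>) (\<lambda>w. w \<in> V - dom \<psi>) u)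
         else \<pi> \<psi> = None))"


lemma is_partial_realization_step:
  assumes "is_policy V E \<pi>" "is_partial_realization V E \<psi>"
  shows "is_partial_realization V E (policy_step E \<pi> \<phi> \<psi>)"
proof (cases "\<pi> \<psi>")
  case None
  then show ?thesis using assms by (simp add: policy_step_def)
next
  case (Some u)
  then have "u \<in> V" using assms unfolding is_policy_def by blast
  moreover have "feedback E \<phi> u \<subseteq> E `` {u}"
    by (auto simp: feedback_def live_edges_def)
  ultimately show ?thesis using assms Some
    by (auto simp: policy_step_def is_partial_realization_def)
qed

lemma is_partial_realization_run:
  assumes "is_policy V E \<pi>"
  shows "is_partial_realization V E ((policy_step E \<pi> \<phi> ^^ n) Map.empty)"
proof (induction n)
  case 0
  show ?case by (simp add: is_partial_realization_def)
next
  case (Suc n)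
  then show ?case by (simp add: is_partial_realization_step[OF assms])
qed

lemma selected_subset: "is_policy V E \<pi> \<Longrightarrow> selected E \<pi> \<phi> \<subseteq> V"
  using is_partial_realization_run[of V E \<pi> _ \<phi>]
  unfolding selected_def is_partial_realization_def dom_def by blast

lemma influence_graph_finite_edges: "influence_graph V E p \<Longrightarrow> finite E"
  unfolding influence_graph_def using finite_subset by blast

lemma finite_set_realization_pmf:
  assumes "finite E"
  shows "finite (set_pmf (realization_pmf E p))"
  unfolding realization_pmf_def
  by (rule finite_subset[OF set_Pi_pmf_subset'[OF assms]])
     (auto intro!: finite_PiE_dflt assms)

lemma finite_adaptive_spreads:
  assumes "influence_graph V E p"
  shows "finite (adaptive_spread E p ` policies V E k)"
proof -
  let ?P = "realization_pmf E p"
  let ?A = "set_pmf ?P"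
  let ?F = "\<lambda>g. measure_pmf.expectation ?P (\<lambda>\<phi>. cascade_size E (g \<phi>) \<phi>)"
  have fin: "finite ?A"
    using finite_set_realization_pmf influence_graph_finite_edges assms by blast
  have "adaptive_spread E p \<pi> \<in> ?F ` (?A \<rightarrow>\<^sub>E Pow V)" if "\<pi> \<in> policies V E k" for \<pi>
  proof
    show "restrict (selected E \<pi>) ?A \<in> ?A \<rightarrow>\<^sub>E Pow V"
      using that selected_subset unfolding policies_def by fastforce
    show "adaptive_spread E p \<pi> = ?F (restrict (selected E \<pi>) ?A)"
      unfolding adaptive_spread_def
      by (rule integral_cong_AE) (auto simp: AE_measure_pmf_iff)
  qed
  moreover have "finite (?A \<rightarrow>\<^sub>E Pow V)"
    using fin assms unfolding influence_graph_def by (intro finite_PiE) auto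
  ultimately show ?thesis
    by (meson finite_imageI finite_subset image_subsetI)
qed

lemma stop_in_policies: "(\<lambda>_. None) \<in> policies V E k"
proof -
  have "(policy_step E (\<lambda>_. None) \<phi> ^^ n) Map.empty = Map.empty" for \<phi> n
    by (induction n) (auto simp: policy_step_def)
  then show ?thesis
    by (simp add: policies_def is_policy_def selected_def)
qed

lemma opt_adaptive_attained:
  assumes "influence_graph V E p"
  shows "\<exists>\<pi>\<in>policies V E k. opt_adaptive V E p k = adaptive_spread E p \<pi> \<and>
           (\<forall>\<pi>'\<in>policies V E k. adaptive_spread E p \<pi>' \<le> adaptive_spread E p \<pi>)"
proof -
  let ?X = "adaptive_spread E p ` policies V E k"
  have fin: "finite ?X" by (rule finite_adaptive_spreads[OF assms])
  then have "Max ?X \<in> ?X" using stop_in_policies by (intro Max_in) blast+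
  then obtain \<pi> where "\<pi> \<in> policies V E k" "Max ?X = adaptive_spread E p \<pi>" by auto
  moreover have "adaptive_spread E p \<pi>' \<le> Max ?X" if "\<pi>' \<in> policies V E k" for \<pi>'
    using fin that by simp
  ultimately show ?thesis unfolding opt_adaptive_def by auto
qed

lemma ex_is_arg_max_finite:
  fixes f :: "'a \<Rightarrow> real"
  assumes "finite A" "A \<noteq> {}"
  shows "\<exists>u. is_arg_max f (\<lambda>w. w \<in> A) u"
proof -
  have "Max (f ` A) \<in> f ` A" using assms by (intro Max_in) auto
  then obtain u where "u \<in> A" "f u = Max (f ` A)" by auto
  then have "is_arg_max f (\<lambda>w. w \<in> A) u"
    using assms by (auto simp: is_arg_max_def not_less)
  then show ?thesis by blast
qed

lemma greedy_output_exists: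
  assumes "influence_graph V E p" "k \<le> card V"
  shows "\<exists>S. greedy_output V E p k S"
proof -
  have finV: "finite V" using assms by (simp add: influence_graph_def)
  have "\<exists>S. greedy_state V E p k S \<and> S \<subseteq> V \<and> card S = j" if "j \<le> k" for j
    using that
  proof (induction j)
    case 0
    show ?case using greedy_state.start by (intro exI[of _ "{}"]) auto
  next
    case (Suc j)
    then obtain S where S: "greedy_state V E p k S" "S \<subseteq> V" "card S = j" by auto
    then have "V - S \<noteq> {}" using Suc.prems assms(2) by auto
    then obtain u where u: "is_arg_max (gain E p S) (\<lambda>w. w \<in> V - S) u"
      using ex_is_arg_max_finite[of "V - S"] finV by auto
    have "greedy_state V E p k (S \<union> {u})"
      by (rule greedy_state.add[OF S(1) _ u]) (use S(3) Suc.prems in simp)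
    moreover have "u \<in> V - S" using u by (simp add: is_arg_max_def)
    moreover have "finite S" using S(2) finV finite_subset by blast
    ultimately show ?case using S by (intro exI[of _ "S \<union> {u}"]) auto
  qed
  then show ?thesis unfolding greedy_output_def by (metis le_refl less_irrefl)
qed

lemma adaptive_greedy_exists:
  assumes "influence_graph V E p" "k \<le> card V"
  shows "\<exists>\<pi>. adaptive_greedy V E p k \<pi>"
proof -
  have finV: "finite V" using assms by (simp add: influence_graph_def)
  define \<pi> :: "'a policy" where "\<pi> \<psi> = (if card (dom \<psi>) < k
    then Some (SOME u. is_arg_max (cond_gain E p \<psi>) (\<lambda>w. w \<in> V - dom \<psi>) u) else None)" for \<psi>
  have "is_arg_max (cond_gain E p \<psi>) (\<lambda>w. w \<in> V - dom \<psi>)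
          (SOME u. is_arg_max (cond_gain E p \<psi>) (\<lambda>w. w \<in> V - dom \<psi>) u)"
    if "is_partial_realization V E \<psi>" "card (dom \<psi>) < k" for \<psi>
  proof (rule someI_ex, rule ex_is_arg_max_finite)
    have "dom \<psi> \<subseteq> V" using that(1) by (auto simp: is_partial_realization_def)
    then show "V - dom \<psi> \<noteq> {}" using that(2) assms(2) by auto
  qed (use finV in simp)
  then have "adaptive_greedy V E p k \<pi>"
    unfolding adaptive_greedy_def \<pi>_def
    by (smt (verit, del_insts) is_arg_max_def)
  then show ?thesis by blast
qed

end

theory Submission
  imports Defs
begin

text \<open>
  The adaptivity gap is at most 4. Let \<open>S\<close> be the random seed set of a policy, determined by the
  realization \<open>\<phi>\<close>, let \<open>\<phi>'\<close> be an independent realization, and let \<open>N(S, \<phi>)\<close> be \<open>S\<close> together with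
  its live out-neighbours. The edges leaving \<open>V - S\<close> are independent of the run, so resampling them
  shows that the adaptive spread is at most the mean of \<open>\<sigma>(N(S, \<phi>))\<close>. Adding the seeds one at a time,
  the out-edges of the next seed in \<open>\<phi>\<close> and \<open>\<phi>'\<close> are exchangeable given the past, and submodularity
  of \<open>\<sigma>\<close> gives that this mean is at most twice the mean of \<open>\<sigma>(N(S, \<phi>'))\<close>. Finally the mean of
  \<open>\<sigma>(N(T, \<phi>'))\<close> is at most \<open>2 \<sigma>(T)\<close> for every fixed set \<open>T\<close>.

  Both greedy algorithms are within \<open>1 - 1/e\<close> of every fixed seed set. For adaptive greedy this needs
  no adaptive submodularity: against a fixed set it suffices that \<open>f(\<cdot>, \<phi>)\<close> is submodular for each
  \<open>\<phi>\<close>, averaged over the realizations consistent with the current feedback.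
\<close>

section \<open>Expectations over finitely supported distributions\<close>

lemma expectation_mono_finite:
  fixes f g :: "'b \<Rightarrow> real"
  assumes "finite (set_pmf M)" "\<And>x. x \<in> set_pmf M \<Longrightarrow> f x \<le> g x"
  shows "measure_pmf.expectation M f \<le> measure_pmf.expectation M g"
  by (rule integral_mono_AE)
     (use assms in \<open>auto intro: integrable_measure_pmf_finite simp: AE_measure_pmf_iff\<close>)

lemma expectation_bind_finite:
  fixes h :: "'c \<Rightarrow> real"
  assumes "finite (set_pmf M)" "\<And>x. x \<in> set_pmf M \<Longrightarrow> finite (set_pmf (F x))"
  shows "measure_pmf.expectation (M \<bind> F) h =
    measure_pmf.expectation M (\<lambda>x. measure_pmf.expectation (F x) h)"
proof -
  have "measure_pmf.expectation (M \<bind> F) h =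
      (\<Sum>x\<in>set_pmf M. pmf M x *\<^sub>R measure_pmf.expectation (F x) h)"
    by (rule pmf_expectation_bind) (use assms in auto)
  also have "\<dots> = measure_pmf.expectation M (\<lambda>x. measure_pmf.expectation (F x) h)"
    by (rule integral_measure_pmf[symmetric]) (use assms in \<open>auto simp: set_pmf_iff\<close>)
  finally show ?thesis .
qed

lemma expectation_pair_finite:
  fixes h :: "'b \<Rightarrow> 'c \<Rightarrow> real"
  assumes "finite (set_pmf M)" "finite (set_pmf N)"
  shows "measure_pmf.expectation (pair_pmf M N) (\<lambda>x. h (fst x) (snd x)) =
    measure_pmf.expectation M (\<lambda>x. measure_pmf.expectation N (h x))"
proof -
  have "measure_pmf.expectation (pair_pmf M N) (\<lambda>x. h (fst x) (snd x)) =
      measure_pmf.expectation M (\<lambda>x. measure_pmf.expectation (N \<bind> (\<lambda>y. return_pmf (x, y)))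
        (\<lambda>x. h (fst x) (snd x)))"
    unfolding pair_pmf_def by (rule expectation_bind_finite) (use assms in auto)
  also have "\<dots> = measure_pmf.expectation M (\<lambda>x. measure_pmf.expectation N (h x))"
    using assms by (simp add: expectation_bind_finite)
  finally show ?thesis .
qed

text \<open>Drawing \<open>x\<close> from \<open>M\<close> and then resampling inside the fibre of
  \<open>s\<close> through \<open>x\<close> gives back \<open>M\<close>. With \<open>s\<close> the
  state of a run, this is the tower rule over the feedback seen so far.\<close>

lemma expectation_cond_fibre:
  fixes h :: "'b \<Rightarrow> real"
  assumes "finite (set_pmf M)"
  shows "measure_pmf.expectation M h =
    measure_pmf.expectation M (\<lambda>x. measure_pmf.expectation (cond_pmf M {y. s y = s x}) h)"
proof -
  have "M \<bind> (\<lambda>x. cond_pmf M {y. s y = s x}) = M"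
    by (rule bind_cond_pmf_cancel) (auto simp: eq_commute)
  then have "measure_pmf.expectation M h =
      measure_pmf.expectation (M \<bind> (\<lambda>x. cond_pmf M {y. s y = s x})) h"
    by simp
  also have "\<dots> = measure_pmf.expectation M
      (\<lambda>x. measure_pmf.expectation (cond_pmf M {y. s y = s x}) h)"
  proof (rule expectation_bind_finite[OF assms])
    fix x assume "x \<in> set_pmf M"
    then have "set_pmf M \<inter> {y. s y = s x} \<noteq> {}" by auto
    then show "finite (set_pmf (cond_pmf M {y. s y = s x}))"
      using assms by (simp add: set_cond_pmf)
  qed
  finally show ?thesis .
qed

section \<open>Exchanging edges between two independent realizations\<close>

definition exchange ::
  "('a \<times> 'a) set \<Rightarrow> 'a realization \<times> 'a realization \<Rightarrow> 'a realization \<times> 'a realization" where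
  "exchange D \<omega> = (\<lambda>e. if e \<in> D then snd \<omega> e else fst \<omega> e, \<lambda>e. if e \<in> D then fst \<omega> e else snd \<omega> e)"

lemma exchange_exchange [simp]: "exchange D (exchange D \<omega>) = \<omega>"
  by (auto simp: exchange_def prod_eq_iff)

text \<open>Grouping the two factors of each edge writes the pair's probability as one product over
  \<open>E\<close>; exchanging an edge merely commutes its two factors.\<close>

lemma pmf_pair_exchange:
  assumes "finite E"
  shows "pmf (pair_pmf (realization_pmf E p) (realization_pmf E p)) (exchange D \<omega>) =
    pmf (pair_pmf (realization_pmf E p) (realization_pmf E p)) \<omega>"
proof -
  have pr: "pmf (pair_pmf (realization_pmf E p) (realization_pmf E p)) (\<phi>, \<phi>') =
    (if \<forall>e. e \<notin> E \<longrightarrow> \<not> \<phi> e \<and> \<not> \<phi>' e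
     then \<Prod>e\<in>E. pmf (bernoulli_pmf (p e)) (\<phi> e) * pmf (bernoulli_pmf (p e)) (\<phi>' e) else 0)"
    for \<phi> \<phi>'
    unfolding pmf_pair realization_pmf_def pmf_Pi[OF assms] by (auto simp: prod.distrib)
  obtain \<phi> \<phi>' where \<omega>: "\<omega> = (\<phi>, \<phi>')" by fastforce
  have "(\<forall>e. e \<notin> E \<longrightarrow> \<not> (if e \<in> D then \<phi>' e else \<phi> e) \<and> \<not> (if e \<in> D then \<phi> e else \<phi>' e)) \<longleftrightarrow>
        (\<forall>e. e \<notin> E \<longrightarrow> \<not> \<phi> e \<and> \<not> \<phi>' e)"
    by auto
  moreover have "(\<Prod>e\<in>E. pmf (bernoulli_pmf (p e)) (if e \<in> D then \<phi>' e else \<phi> e) *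
          pmf (bernoulli_pmf (p e)) (if e \<in> D then \<phi> e else \<phi>' e)) =
      (\<Prod>e\<in>E. pmf (bernoulli_pmf (p e)) (\<phi> e) * pmf (bernoulli_pmf (p e)) (\<phi>' e))"
    by (intro prod.cong) simp_all
  ultimately show ?thesis
    unfolding \<omega> exchange_def fst_conv snd_conv pr by (simp only:)
qed

text \<open>The exchanged set may depend on the pair itself. Since the exchange leaves it unchanged,
  the map is its own inverse, hence injective, and it preserves every point mass.\<close>

lemma expectation_exchange:
  assumes "finite E" and D: "\<And>\<omega>. D (exchange (D \<omega>) \<omega>) = D \<omega>"
  shows "measure_pmf.expectation (pair_pmf (realization_pmf E p) (realization_pmf E p))
      (\<lambda>\<omega>. h (exchange (D \<omega>) \<omega>)) =
    measure_pmf.expectation (pair_pmf (realization_pmf E p) (realization_pmf E p)) (h :: _ \<Rightarrow> real)"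
proof -
  let ?Q = "pair_pmf (realization_pmf E p) (realization_pmf E p)"
  let ?t = "\<lambda>\<omega>. exchange (D \<omega>) \<omega>"
  have inv: "?t (?t \<omega>) = \<omega>" for \<omega> by (simp add: D)
  then have "inj ?t" by (rule inj_on_inverseI)
  have preserved: "map_pmf ?t ?Q = ?Q"
  proof (rule pmf_eqI)
    fix \<omega>
    have "pmf (map_pmf ?t ?Q) (?t (?t \<omega>)) = pmf ?Q (?t \<omega>)"
      using \<open>inj ?t\<close> by (rule pmf_map_inj')
    then show "pmf (map_pmf ?t ?Q) \<omega> = pmf ?Q \<omega>"
      using pmf_pair_exchange[OF assms(1)] by (simp only: inv)
  qed
  have "measure_pmf.expectation (map_pmf ?t ?Q) h = measure_pmf.expectation ?Q (\<lambda>\<omega>. h (?t \<omega>))"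
    by (rule integral_map_pmf)
  then show ?thesis unfolding preserved by (rule sym)
qed

section \<open>Reachability\<close>

text \<open>The set \<open>N(S, \<phi>)\<close> of the overview.\<close>

definition outs :: "('a \<times> 'a) set \<Rightarrow> 'a set \<Rightarrow> 'a realization \<Rightarrow> 'a set" where
  "outs E S \<phi> = S \<union> live_edges E \<phi> `` S"

lemma outs_Un: "outs E (S \<union> T) \<phi> = outs E S \<phi> \<union> outs E T \<phi>"
  by (auto simp: outs_def)

lemma outs_cong:
  "(\<And>e. e \<in> E \<Longrightarrow> fst e \<in> S \<Longrightarrow> \<phi> e = \<phi>' e) \<Longrightarrow> outs E S \<phi> = outs E S \<phi>'"
  by (fastforce simp: outs_def live_edges_def)

lemma subset_reached: "S \<subseteq> reached E S \<phi>"
  by (auto simp: reached_def)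

lemma reached_Un: "reached E (S \<union> T) \<phi> = reached E S \<phi> \<union> reached E T \<phi>"
  by (auto simp: reached_def)

lemma reached_step: "y \<in> reached E S \<phi> \<Longrightarrow> (y, z) \<in> live_edges E \<phi> \<Longrightarrow> z \<in> reached E S \<phi>"
  unfolding reached_def by (auto intro: rtrancl_into_rtrancl)

lemma reached_induct [consumes 1, case_names base step]:
  assumes "x \<in> reached E S \<phi>" "\<And>x. x \<in> S \<Longrightarrow> P x"
    "\<And>y z. y \<in> reached E S \<phi> \<Longrightarrow> (y, z) \<in> live_edges E \<phi> \<Longrightarrow> P y \<Longrightarrow> P z"
  shows "P x"
proof -
  obtain s where "s \<in> S" "(s, x) \<in> (live_edges E \<phi>)\<^sup>*" using assms(1) by (auto simp: reached_def)
  from this(2) show ?thesis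
  proof (induction rule: rtrancl_induct)
    case base
    then show ?case using \<open>s \<in> S\<close> assms(2) by blast
  next
    case (step y z)
    have "y \<in> reached E S \<phi>" using step.hyps(1) \<open>s \<in> S\<close> by (auto simp: reached_def)
    then show ?case using step assms(3) by blast
  qed
qed

text \<open>The exchanged realization follows \<open>\<phi>\<close> on edges leaving
  \<open>S\<close> and \<open>\<phi>'\<close> on all others. A step from inside \<open>S\<close>
  therefore lands in \<open>outs E S \<phi>\<close>, and a step from outside \<open>S\<close> is
  live in \<open>\<phi>'\<close>.\<close>

lemma reached_exchange_subset:
  "reached E S (fst (exchange {e. fst e \<notin> S} (\<phi>, \<phi>'))) \<subseteq> reached E (outs E S \<phi>) \<phi>'"
proof
  fix x assume "x \<in> reached E S (fst (exchange {e. fst e \<notin> S} (\<phi>, \<phi>')))"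
  then show "x \<in> reached E (outs E S \<phi>) \<phi>'"
  proof (induction rule: reached_induct)
    case (base x)
    then show ?case using subset_reached[of "outs E S \<phi>" E \<phi>'] by (auto simp: outs_def)
  next
    case (step y z)
    show ?case
    proof (cases "y \<in> S")
      case True
      then have "z \<in> outs E S \<phi>" using step.hyps
        by (auto simp: outs_def live_edges_def exchange_def)
      then show ?thesis using subset_reached by fast
    next
      case False
      then have "(y, z) \<in> live_edges E \<phi>'" using step.hyps
        by (auto simp: live_edges_def exchange_def)
      with step.IH show ?thesis by (rule reached_step)
    qed
  qed
qed

text \<open>Along a path in \<open>\<phi>'\<close>, a node reached from \<open>S\<close> in
  \<open>\<phi>'\<close> passes this on to its successors. Any other node lies outside
  \<open>S\<close>, where the mixed realization agrees with \<open>\<phi>'\<close>, so the path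
  continues there.\<close>

lemma reached_outs_subset:
  "reached E (outs E S \<phi>) \<phi>' \<subseteq>
    reached E S \<phi>' \<union> reached E S (fst (exchange {e. fst e \<notin> S} (\<phi>, \<phi>')))"
proof
  let ?\<chi> = "fst (exchange {e. fst e \<notin> S} (\<phi>, \<phi>'))"
  fix x assume "x \<in> reached E (outs E S \<phi>) \<phi>'"
  then show "x \<in> reached E S \<phi>' \<union> reached E S ?\<chi>"
  proof (induction rule: reached_induct)
    case (base x)
    have S: "y \<in> S \<Longrightarrow> y \<in> reached E S ?\<chi>" for y using subset_reached by fast
    from base consider "x \<in> S" | s where "s \<in> S" "(s, x) \<in> live_edges E ?\<chi>"
      by (auto simp: outs_def live_edges_def exchange_def)
    then have "x \<in> reached E S ?\<chi>" by cases (auto intro: S reached_step)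
    then show ?case ..
  next
    case (step y z)
    show ?case
    proof (cases "y \<in> reached E S \<phi>'")
      case True
      then show ?thesis using step.hyps reached_step by fast
    next
      case False
      then have "y \<notin> S" using subset_reached by fast
      then have "(y, z) \<in> live_edges E ?\<chi>" using step.hyps
        by (auto simp: live_edges_def exchange_def)
      moreover have "y \<in> reached E S ?\<chi>" using False step.IH by blast
      ultimately show ?thesis by (auto intro: reached_step)
    qed
  qed
qed

section \<open>Runs of a policy\<close>

definition run_state ::
  "('a \<times> 'a) set \<Rightarrow> 'a policy \<Rightarrow> 'a realization \<Rightarrow> nat \<Rightarrow> 'a partial_realization" where
  "run_state E \<pi> \<phi> n = (policy_step E \<pi> \<phi> ^^ n) Map.empty"

lemma run_state_0 [simp]: "run_state E \<pi> \<phi> 0 = Map.empty"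
  and run_state_Suc [simp]: "run_state E \<pi> \<phi> (Suc n) = policy_step E \<pi> \<phi> (run_state E \<pi> \<phi> n)"
  by (auto simp: run_state_def)

lemma dom_policy_step: "dom (policy_step E \<pi> \<phi> \<psi>) = dom \<psi> \<union> set_option (\<pi> \<psi>)"
  by (cases "\<pi> \<psi>") (auto simp: policy_step_def)

lemma dom_run_state_subset_selected: "dom (run_state E \<pi> \<phi> n) \<subseteq> selected E \<pi> \<phi>"
  unfolding selected_def run_state_def by blast

lemma consistent_run_state: "consistent E \<phi> (run_state E \<pi> \<phi> n)"
proof (induction n)
  case 0
  show ?case by (simp add: consistent_def)
next
  case (Suc n)
  then show ?case
    by (cases "\<pi> (run_state E \<pi> \<phi> n)") (auto simp: consistent_def policy_step_def)
qed

lemma consistent_cong: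
  assumes "consistent E \<phi> \<psi>" "\<And>e. e \<in> E \<Longrightarrow> fst e \<in> dom \<psi> \<Longrightarrow> \<phi>' e = \<phi> e"
  shows "consistent E \<phi>' \<psi>"
proof -
  have "feedback E \<phi>' u = feedback E \<phi> u" if "u \<in> dom \<psi>" for u
    using assms(2) that by (fastforce simp: feedback_def live_edges_def)
  then show ?thesis using assms(1) by (simp add: consistent_def)
qed

locale influence =
  fixes V :: "'a set" and E :: "('a \<times> 'a) set" and p :: "'a \<times> 'a \<Rightarrow> real"
  assumes graph: "influence_graph V E p"
begin

abbreviation "P \<equiv> realization_pmf E p"
abbreviation "\<sigma> \<equiv> spread E p"

lemma finite_V: "finite V" and E_subset: "E \<subseteq> V \<times> V"
  using graph by (auto simp: influence_graph_def)

lemma finite_E: "finite E"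
  using graph by (rule influence_graph_finite_edges)

lemma finite_P [simp]: "finite (set_pmf P)"
  by (rule finite_set_realization_pmf[OF finite_E])

lemma integrable_P [simp]: "integrable P (f :: _ \<Rightarrow> real)"
  by (rule integrable_measure_pmf_finite) simp

lemma integrable_PP [simp]: "integrable (pair_pmf P P) (f :: _ \<Rightarrow> real)"
  by (rule integrable_measure_pmf_finite) simp

section \<open>Monotonicity and submodularity of cascade size and spread\<close>

lemma reached_subset_V: "S \<subseteq> V \<Longrightarrow> reached E S \<phi> \<subseteq> V"
proof
  fix x assume "S \<subseteq> V" "x \<in> reached E S \<phi>"
  from this(2,1) show "x \<in> V"
    by (induction rule: reached_induct) (use E_subset in \<open>auto simp: live_edges_def\<close>)
qed

lemma finite_reached: "S \<subseteq> V \<Longrightarrow> finite (reached E S \<phi>)"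
  using reached_subset_V finite_V by (rule finite_subset)

lemma outs_subset_V: "S \<subseteq> V \<Longrightarrow> outs E S \<phi> \<subseteq> V"
  using E_subset by (auto simp: outs_def live_edges_def)

lemma cascade_size_mono:
  "S \<subseteq> T \<Longrightarrow> T \<subseteq> V \<Longrightarrow> cascade_size E S \<phi> \<le> cascade_size E T \<phi>"
  unfolding cascade_size_def
  by (intro of_nat_mono card_mono finite_reached) (auto simp: reached_def)

text \<open>Adding \<open>C\<close> to \<open>X\<close> contributes exactly the nodes reached from
  \<open>C\<close> but not from \<open>X\<close>, a set that shrinks as \<open>X\<close>
  grows.\<close>

lemma cascade_size_submod:
  assumes "A \<subseteq> B" "B \<subseteq> V" "C \<subseteq> V"
  shows "cascade_size E (B \<union> C) \<phi> - cascade_size E B \<phi> \<le> cascade_size E (A \<union> C) \<phi> - cascade_size E A \<phi>"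
proof -
  have gain: "cascade_size E (X \<union> C) \<phi> - cascade_size E X \<phi> = real (card (reached E C \<phi> - reached E X \<phi>))"
    if "X \<subseteq> V" for X
  proof -
    have fin: "finite (reached E X \<phi>)" "finite (reached E C \<phi>)"
      using that assms(3) by (auto intro: finite_reached)
    have "reached E (X \<union> C) \<phi> = reached E X \<phi> \<union> (reached E C \<phi> - reached E X \<phi>)"
      by (auto simp: reached_Un)
    then have "card (reached E (X \<union> C) \<phi>) = card (reached E X \<phi>) + card (reached E C \<phi> - reached E X \<phi>)"
      using fin by (simp only:, subst card_Un_disjoint) auto
    then show ?thesis by (simp add: cascade_size_def)
  qed
  have "reached E A \<phi> \<subseteq> reached E B \<phi>"
    using assms(1) by (auto simp: reached_def)
  moreover have "finite (reached E C \<phi>)"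
    using assms(3) by (rule finite_reached)
  ultimately have "card (reached E C \<phi> - reached E B \<phi>) \<le> card (reached E C \<phi> - reached E A \<phi>)"
    by (intro card_mono) auto
  then show ?thesis using gain[of A] gain[of B] assms by simp
qed

lemma spread_mono: "S \<subseteq> T \<Longrightarrow> T \<subseteq> V \<Longrightarrow> \<sigma> S \<le> \<sigma> T"
  unfolding spread_def by (rule expectation_mono_finite) (auto intro: cascade_size_mono)

lemma spread_submod:
  assumes "A \<subseteq> B" "B \<subseteq> V" "C \<subseteq> V"
  shows "\<sigma> (B \<union> C) - \<sigma> B \<le> \<sigma> (A \<union> C) - \<sigma> A"
  using expectation_mono_finite[OF finite_P, OF cascade_size_submod[OF assms]]
  by (simp add: spread_def)

lemma spread_empty [simp]: "\<sigma> {} = 0"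
  by (simp add: spread_def cascade_size_def[abs_def] reached_def)

text \<open>Proved for each realization, so that it can be averaged both under \<open>P\<close> and
  under \<open>P\<close> conditioned on feedback.\<close>

lemma cascade_size_Un_le_sum:
  assumes "A \<subseteq> V" "T \<subseteq> V"
  shows "cascade_size E (A \<union> T) \<phi> - cascade_size E A \<phi> \<le>
    (\<Sum>w\<in>T. cascade_size E (A \<union> {w}) \<phi> - cascade_size E A \<phi>)"
proof -
  have "finite T" using assms finite_V finite_subset by blast
  then show ?thesis using assms(2)
  proof induction
    case empty
    show ?case by simp
  next
    case (insert w T)
    have "cascade_size E (A \<union> T \<union> {w}) \<phi> - cascade_size E (A \<union> T) \<phi> \<le>
        cascade_size E (A \<union> {w}) \<phi> - cascade_size E A \<phi>"
      by (rule cascade_size_submod) (use insert assms in auto)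
    then show ?case using insert by simp
  qed
qed

lemma spread_Un_le_sum:
  assumes "A \<subseteq> V" "T \<subseteq> V"
  shows "\<sigma> (A \<union> T) - \<sigma> A \<le> (\<Sum>w\<in>T. gain E p A w)"
  using expectation_mono_finite[OF finite_P, OF cascade_size_Un_le_sum[OF assms]]
  by (simp add: spread_def gain_def Bochner_Integration.integral_sum)

section \<open>Dependence of a run on the revealed edges\<close>

lemma next_seed_new:
  assumes "is_policy V E \<pi>" "\<pi> (run_state E \<pi> \<phi> n) = Some u"
  shows "u \<in> V" "u \<notin> dom (run_state E \<pi> \<phi> n)"
  using is_partial_realization_run[OF assms(1), of n \<phi>] assms
  unfolding is_policy_def run_state_def by blast+

text \<open>New seeds never overwrite old feedback, so consistency with a state implies consistency
  with the earlier ones, and by induction both runs make the same choices. Hence conditioning on a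
  state and conditioning on consistency with it are the same.\<close>

lemma run_state_consistent_cong:
  assumes "is_policy V E \<pi>" "consistent E \<phi>' (run_state E \<pi> \<phi> n)"
  shows "run_state E \<pi> \<phi>' n = run_state E \<pi> \<phi> n"
  using assms(2)
proof (induction n)
  case 0
  show ?case by simp
next
  case (Suc n)
  let ?\<psi> = "run_state E \<pi> \<phi> n"
  show ?case
  proof (cases "\<pi> ?\<psi>")
    case None
    then show ?thesis using Suc by (simp add: policy_step_def)
  next
    case (Some u)
    have new: "u \<notin> dom ?\<psi>" by (rule next_seed_new(2)[OF assms(1) Some])
    have next_state: "run_state E \<pi> \<phi> (Suc n) = ?\<psi>(u \<mapsto> feedback E \<phi> u)"
      using Some by (simp add: policy_step_def)
    then have c: "consistent E \<phi>' (?\<psi>(u \<mapsto> feedback E \<phi> u))"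
      using Suc.prems by (simp only:)
    have "consistent E \<phi>' ?\<psi>"
      unfolding consistent_def
    proof
      fix v assume "v \<in> dom ?\<psi>"
      moreover from this new have "v \<noteq> u" by blast
      ultimately show "?\<psi> v = Some (feedback E \<phi>' v)"
        using bspec[OF c[unfolded consistent_def], of v] by simp
    qed
    then have "run_state E \<pi> \<phi>' n = ?\<psi>" by (rule Suc.IH)
    moreover have "feedback E \<phi> u = feedback E \<phi>' u"
      using c by (auto simp: consistent_def)
    ultimately show ?thesis using Some by (simp add: policy_step_def)
  qed
qed

lemma run_state_cong:
  assumes "is_policy V E \<pi>"
    and "\<And>e. e \<in> E \<Longrightarrow> fst e \<in> dom (run_state E \<pi> \<phi> n) \<Longrightarrow> \<phi>' e = \<phi> e"
  shows "run_state E \<pi> \<phi>' n = run_state E \<pi> \<phi> n"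
  using run_state_consistent_cong[OF assms(1)] consistent_cong[OF consistent_run_state] assms(2)
  by blast

lemma dom_run_state_subset_V: "is_policy V E \<pi> \<Longrightarrow> dom (run_state E \<pi> \<phi> n) \<subseteq> V"
  using dom_run_state_subset_selected selected_subset by (metis order_trans)

text \<open>Every proper step adds a new node, so the run has stopped after \<open>card V\<close>
  steps. This fixed horizon allows induction on the number of steps.\<close>

lemma selected_eq_run_state:
  assumes \<pi>: "is_policy V E \<pi>"
  shows "selected E \<pi> \<phi> = dom (run_state E \<pi> \<phi> (card V))"
proof -
  let ?s = "run_state E \<pi> \<phi>"
  have card: "card (dom (?s n)) = n" if "\<pi> (?s n) \<noteq> None" for n
    using that
  proof (induction n)
    case 0
    show ?case by simp
  next
    case (Suc n)
    have "\<pi> (?s n) \<noteq> None" using Suc.prems by (cases "\<pi> (?s n)") (auto simp: policy_step_def)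
    then obtain u where u: "\<pi> (?s n) = Some u" by auto
    have "finite (dom (?s n))" using dom_run_state_subset_V[OF \<pi>] finite_V finite_subset by blast
    then show ?case
      using Suc.IH u next_seed_new(2)[OF \<pi> u] by (simp add: dom_policy_step)
  qed
  \<comment> \<open>A policy still active after \<open>card V\<close> steps would have selected all
    of \<open>V\<close> and would have no new node to choose.\<close>
  have stop: "\<pi> (?s (card V)) = None"
  proof (rule ccontr)
    assume "\<pi> (?s (card V)) \<noteq> None"
    then obtain u where u: "\<pi> (?s (card V)) = Some u" by auto
    then have "dom (?s (card V)) = V"
      using card[of "card V"] dom_run_state_subset_V[OF \<pi>] finite_V by (simp add: card_subset_eq)
    then show False using next_seed_new[OF \<pi> u] by blast
  qed
  have stay: "?s (card V + m) = ?s (card V)" for m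
    by (induction m) (auto simp: policy_step_def stop)
  have mono: "dom (?s m) \<subseteq> dom (?s (m + d))" for m d
    by (induction d) (auto simp: dom_policy_step)
  have "dom (?s n) \<subseteq> dom (?s (card V))" for n
    using stay[of "n - card V"] mono[of n "card V - n"] by (cases "n \<le> card V") auto
  then show ?thesis unfolding selected_def run_state_def[symmetric] by blast
qed

section \<open>The adaptivity gap\<close>

text \<open>The final seed set is determined by the edges leaving it, so exchanging all other edges
  preserves it. This is the invariance that \<open>expectation_exchange\<close> requires.\<close>

lemma adaptive_spread_le_outs:
  assumes \<pi>: "is_policy V E \<pi>"
  shows "adaptive_spread E p \<pi> \<le> measure_pmf.expectation P (\<lambda>\<phi>. \<sigma> (outs E (selected E \<pi> \<phi>) \<phi>))"
proof -
  let ?S = "selected E \<pi>"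
  let ?D = "\<lambda>\<omega>. {e. fst e \<notin> ?S (fst \<omega>)}"
  have S: "?S (fst (exchange (?D \<omega>) \<omega>)) = ?S (fst \<omega>)" for \<omega>
    unfolding selected_eq_run_state[OF \<pi>]
    by (rule arg_cong[where f = dom], rule run_state_cong[OF \<pi>]) (simp add: exchange_def)
  have "adaptive_spread E p \<pi> =
      measure_pmf.expectation (pair_pmf P P) (\<lambda>\<omega>. cascade_size E (?S (fst \<omega>)) (fst \<omega>))"
    unfolding adaptive_spread_def by (rule expectation_pair_pmf_fst[symmetric])
  also have "\<dots> = measure_pmf.expectation (pair_pmf P P)
      (\<lambda>\<omega>. cascade_size E (?S (fst (exchange (?D \<omega>) \<omega>))) (fst (exchange (?D \<omega>) \<omega>)))"
    by (rule expectation_exchange[symmetric, OF finite_E]) (simp only: S)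
  also have "\<dots> \<le> measure_pmf.expectation (pair_pmf P P)
      (\<lambda>\<omega>. cascade_size E (outs E (?S (fst \<omega>)) (fst \<omega>)) (snd \<omega>))"
  proof (rule expectation_mono_finite)
    fix \<omega> :: "'a realization \<times> 'a realization"
    obtain \<phi> \<phi>' where \<omega>: "\<omega> = (\<phi>, \<phi>')" by fastforce
    have "finite (reached E (outs E (?S \<phi>) \<phi>) \<phi>')"
      by (rule finite_reached[OF outs_subset_V[OF selected_subset[OF \<pi>]]])
    then show "cascade_size E (?S (fst (exchange (?D \<omega>) \<omega>))) (fst (exchange (?D \<omega>) \<omega>)) \<le>
        cascade_size E (outs E (?S (fst \<omega>)) (fst \<omega>)) (snd \<omega>)"
      unfolding S unfolding cascade_size_def \<omega> fst_conv snd_conv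
      by (intro of_nat_mono card_mono reached_exchange_subset)
  qed simp
  also have "\<dots> = measure_pmf.expectation P (\<lambda>\<phi>. \<sigma> (outs E (?S \<phi>) \<phi>))"
    unfolding spread_def by (rule expectation_pair_finite) simp_all
  finally show ?thesis .
qed

text \<open>A union bound over the two parts in \<open>reached_outs_subset\<close>: the mixed
  realization has the same law as \<open>\<phi>\<close>, so each part has mean
  \<open>\<sigma> S\<close>.\<close>

lemma spread_outs_le:
  assumes "S \<subseteq> V"
  shows "measure_pmf.expectation P (\<lambda>\<phi>. \<sigma> (outs E S \<phi>)) \<le> 2 * \<sigma> S"
proof -
  let ?D = "\<lambda>\<omega>. {e. fst e \<notin> S}"
  have "measure_pmf.expectation P (\<lambda>\<phi>. \<sigma> (outs E S \<phi>)) =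
      measure_pmf.expectation (pair_pmf P P) (\<lambda>\<omega>. cascade_size E (outs E S (fst \<omega>)) (snd \<omega>))"
    unfolding spread_def by (rule expectation_pair_finite[symmetric]) simp_all
  also have "\<dots> \<le> measure_pmf.expectation (pair_pmf P P)
      (\<lambda>\<omega>. cascade_size E S (snd \<omega>) + cascade_size E S (fst (exchange (?D \<omega>) \<omega>)))"
  proof (rule expectation_mono_finite)
    fix \<omega> :: "'a realization \<times> 'a realization"
    obtain \<phi> \<phi>' where \<omega>: "\<omega> = (\<phi>, \<phi>')" by fastforce
    let ?\<chi> = "fst (exchange {e. fst e \<notin> S} (\<phi>, \<phi>'))"
    have "finite (reached E S \<phi>' \<union> reached E S ?\<chi>)"
      using finite_reached[OF assms] by simp
    then have "card (reached E (outs E S \<phi>) \<phi>') \<le> card (reached E S \<phi>' \<union> reached E S ?\<chi>)"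
      by (rule card_mono) (rule reached_outs_subset)
    also have "\<dots> \<le> card (reached E S \<phi>') + card (reached E S ?\<chi>)" by (rule card_Un_le)
    finally show "cascade_size E (outs E S (fst \<omega>)) (snd \<omega>) \<le>
        cascade_size E S (snd \<omega>) + cascade_size E S (fst (exchange (?D \<omega>) \<omega>))"
      unfolding cascade_size_def \<omega> by simp
  qed simp
  also have "\<dots> = measure_pmf.expectation (pair_pmf P P) (\<lambda>\<omega>. cascade_size E S (snd \<omega>)) +
      measure_pmf.expectation (pair_pmf P P) (\<lambda>\<omega>. cascade_size E S (fst (exchange (?D \<omega>) \<omega>)))"
    by simp
  also have "measure_pmf.expectation (pair_pmf P P)
      (\<lambda>\<omega>. cascade_size E S (fst (exchange (?D \<omega>) \<omega>))) =
      measure_pmf.expectation (pair_pmf P P) (\<lambda>\<omega>. cascade_size E S (fst \<omega>))"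
    by (rule expectation_exchange[OF finite_E]) simp
  finally show ?thesis by (simp add: spread_def)
qed

text \<open>The left side carries the union of both neighbourhoods, not only that in the run's own
  realization. It thus contains the set on the right, and submodularity can compare marginal gains
  over the two.\<close>

lemma spread_outs_both_le:
  assumes \<pi>: "is_policy V E \<pi>"
  shows "measure_pmf.expectation (pair_pmf P P)
      (\<lambda>\<omega>. \<sigma> (outs E (dom (run_state E \<pi> (fst \<omega>) n)) (fst \<omega>) \<union>
               outs E (dom (run_state E \<pi> (fst \<omega>) n)) (snd \<omega>))) \<le>
    2 * measure_pmf.expectation (pair_pmf P P)
      (\<lambda>\<omega>. \<sigma> (outs E (dom (run_state E \<pi> (fst \<omega>) n)) (snd \<omega>)))"
proof (induction n)
  case 0
  show ?case by (simp add: outs_def)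
next
  case (Suc n)
  let ?Q = "pair_pmf P P"
  define s where "s \<omega> = run_state E \<pi> (fst \<omega>) n" for \<omega> :: "'a realization \<times> 'a realization"
  define A where "A \<omega> = outs E (dom (s \<omega>)) (fst \<omega>) \<union> outs E (dom (s \<omega>)) (snd \<omega>)" for \<omega>
  define B where "B \<omega> = outs E (dom (s \<omega>)) (snd \<omega>)" for \<omega>
  \<comment> \<open>Empty once the policy has stopped, so that this case needs no separate
    treatment.\<close>
  define U where "U \<omega> = set_option (\<pi> (s \<omega>))" for \<omega>
  define X where "X \<omega> = outs E (U \<omega>) (fst \<omega>)" for \<omega>
  define X' where "X' \<omega> = outs E (U \<omega>) (snd \<omega>)" for \<omega>
  \<comment> \<open>Only the edges leaving the next seed are exchanged. That seed is not in
    \<open>dom (s \<omega>)\<close>, so \<open>s\<close>, \<open>A\<close> and \<open>U\<close> are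
    unaffected, while \<open>X\<close> turns into \<open>X'\<close>.\<close>
  define D where "D \<omega> = {e :: 'a \<times> 'a. fst e \<in> U \<omega>}" for \<omega>
  have new: "U \<omega> \<subseteq> V" "U \<omega> \<inter> dom (s \<omega>) = {}" for \<omega>
    using next_seed_new[OF \<pi>, of "fst \<omega>" n] by (auto simp: U_def s_def)
  have sub: "A \<omega> \<subseteq> V" "B \<omega> \<subseteq> V" "X \<omega> \<subseteq> V" "X' \<omega> \<subseteq> V" "B \<omega> \<subseteq> A \<omega>" for \<omega>
    using outs_subset_V new(1) dom_run_state_subset_V[OF \<pi>]
    by (auto simp: A_def B_def X_def X'_def s_def)
  have s_ex: "s (exchange (D \<omega>) \<omega>) = s \<omega>" for \<omega>
    unfolding s_def using new(2)[of \<omega>]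
    by (intro run_state_cong[OF \<pi>]) (auto simp: exchange_def D_def s_def[symmetric])
  then have U_ex: "U (exchange (D \<omega>) \<omega>) = U \<omega>" for \<omega> by (simp add: U_def)
  have A_ex: "A (exchange (D \<omega>) \<omega>) = A \<omega>" for \<omega>
    unfolding A_def s_ex using new(2)[of \<omega>]
    by (intro arg_cong2[of _ _ _ _ "(\<union>)"] outs_cong) (auto simp: exchange_def D_def)
  have X_ex: "X (exchange (D \<omega>) \<omega>) = X' \<omega>" for \<omega>
    unfolding X_def X'_def U_ex by (rule outs_cong) (auto simp: exchange_def D_def)
  have D_ex: "D (exchange (D \<omega>) \<omega>) = D \<omega>" for \<omega>
    using U_ex[of \<omega>] by (simp add: D_def)
  have sym: "measure_pmf.expectation ?Q (\<lambda>\<omega>. \<sigma> (A \<omega> \<union> X \<omega>)) =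
      measure_pmf.expectation ?Q (\<lambda>\<omega>. \<sigma> (A \<omega> \<union> X' \<omega>))"
    using expectation_exchange[of E D p "\<lambda>\<omega>. \<sigma> (A \<omega> \<union> X \<omega>)", OF finite_E D_ex]
    by (simp add: A_ex X_ex)
  \<comment> \<open>The gains of \<open>X\<close> and \<open>X'\<close> over \<open>A\<close> are
    first separated by submodularity; by \<open>sym\<close> they have the same mean, which produces
    the factor 2.\<close>
  have "measure_pmf.expectation ?Q (\<lambda>\<omega>. \<sigma> (A \<omega> \<union> X \<omega> \<union> X' \<omega>)) \<le>
      measure_pmf.expectation ?Q (\<lambda>\<omega>. \<sigma> (A \<omega> \<union> X \<omega>) + \<sigma> (A \<omega> \<union> X' \<omega>) - \<sigma> (A \<omega>))"
    using spread_submod[of "A _" "A _ \<union> X _" "X' _"] sub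
    by (intro expectation_mono_finite) (auto simp: algebra_simps)
  also have "\<dots> = measure_pmf.expectation ?Q (\<lambda>\<omega>. \<sigma> (A \<omega>)) +
      2 * measure_pmf.expectation ?Q (\<lambda>\<omega>. \<sigma> (A \<omega> \<union> X' \<omega>) - \<sigma> (A \<omega>))"
    by (simp add: sym)
  \<comment> \<open>The induction hypothesis bounds the first term; since
    \<open>B \<omega> \<subseteq> A \<omega>\<close>, the gain of \<open>X'\<close> only grows when
    \<open>A\<close> is replaced by \<open>B\<close>.\<close>
  also have "\<dots> \<le> 2 * measure_pmf.expectation ?Q (\<lambda>\<omega>. \<sigma> (B \<omega>)) +
      2 * measure_pmf.expectation ?Q (\<lambda>\<omega>. \<sigma> (B \<omega> \<union> X' \<omega>) - \<sigma> (B \<omega>))"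
    using Suc.IH sub
    by (intro add_mono mult_left_mono expectation_mono_finite spread_submod)
       (auto simp: A_def B_def s_def)
  also have "\<dots> = 2 * measure_pmf.expectation ?Q (\<lambda>\<omega>. \<sigma> (B \<omega> \<union> X' \<omega>))"
    by simp
  finally show ?case
    by (simp add: A_def B_def X_def X'_def U_def s_def dom_policy_step outs_Un Un_ac)
qed

text \<open>One factor 2 comes from \<open>spread_outs_both_le\<close>. After it the seed set is
  independent of the second realization, so \<open>spread_outs_le\<close> applies to each possible
  seed set as a fixed set and gives the other.\<close>

lemma adaptivity_gap:
  assumes \<pi>: "\<pi> \<in> policies V E k"
    and bound: "\<And>T. T \<subseteq> V \<Longrightarrow> card T \<le> k \<Longrightarrow> \<sigma> T \<le> b"
  shows "adaptive_spread E p \<pi> \<le> 4 * b"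
proof -
  have pol: "is_policy V E \<pi>" and card: "card (selected E \<pi> \<phi>) \<le> k" for \<phi>
    using \<pi> by (auto simp: policies_def)
  let ?S = "selected E \<pi>"
  have "adaptive_spread E p \<pi> \<le> measure_pmf.expectation P (\<lambda>\<phi>. \<sigma> (outs E (?S \<phi>) \<phi>))"
    by (rule adaptive_spread_le_outs[OF pol])
  also have "\<dots> = measure_pmf.expectation (pair_pmf P P) (\<lambda>\<omega>. \<sigma> (outs E (?S (fst \<omega>)) (fst \<omega>)))"
    by (rule expectation_pair_pmf_fst[symmetric])
  also have "\<dots> \<le> measure_pmf.expectation (pair_pmf P P)
      (\<lambda>\<omega>. \<sigma> (outs E (?S (fst \<omega>)) (fst \<omega>) \<union> outs E (?S (fst \<omega>)) (snd \<omega>)))"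
    by (intro expectation_mono_finite spread_mono Un_least outs_subset_V selected_subset[OF pol])
       simp_all
  also have "\<dots> \<le> 2 * measure_pmf.expectation (pair_pmf P P)
      (\<lambda>\<omega>. \<sigma> (outs E (?S (fst \<omega>)) (snd \<omega>)))"
    unfolding selected_eq_run_state[OF pol] by (rule spread_outs_both_le[OF pol])
  also have "\<dots> = 2 * measure_pmf.expectation P
      (\<lambda>\<phi>. measure_pmf.expectation P (\<lambda>\<phi>'. \<sigma> (outs E (?S \<phi>) \<phi>')))"
    by (subst expectation_pair_finite) simp_all
  also have "\<dots> \<le> 2 * measure_pmf.expectation P (\<lambda>\<phi>. 2 * b)"
  proof (intro mult_left_mono expectation_mono_finite)
    fix \<phi>
    have "\<sigma> (?S \<phi>) \<le> b" by (rule bound[OF selected_subset[OF pol] card])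
    then show "measure_pmf.expectation P (\<lambda>\<phi>'. \<sigma> (outs E (?S \<phi>) \<phi>')) \<le> 2 * b"
      using spread_outs_le[OF selected_subset[OF pol], of \<phi>] by linarith
  qed simp_all
  finally show ?thesis by simp
qed

section \<open>Greedy selection\<close>

text \<open>Stated for all \<open>n\<close> from \<open>k\<close> on, because
  \<open>greedy_output\<close> provides \<open>k \<le> card S\<close>.\<close>

lemma power_one_minus_inverse_le:
  assumes "1 \<le> (k :: nat)" "k \<le> n"
  shows "(1 - 1 / real k) ^ n \<le> 1 / exp 1"
proof -
  have "(1 - 1 / real k) ^ n \<le> (1 - 1 / real k) ^ k"
    using assms by (intro power_decreasing) auto
  also have "\<dots> \<le> exp (- (1 / real k)) ^ k"
    using assms exp_ge_add_one_self[of "- (1 / real k)"] by (intro power_mono) auto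
  also have "\<dots> = exp (real k * - (1 / real k))"
    by (simp only: exp_of_nat_mult)
  also have "\<dots> = 1 / exp 1"
    using assms by (simp add: exp_minus inverse_eq_divide)
  finally show ?thesis .
qed

text \<open>The gap \<open>\<sigma> T - \<sigma> S\<close> is at most the sum of at most
  \<open>k\<close> gains, each bounded by that of the greedy choice. Hence each step shrinks the gap
  by a factor \<open>1 - 1/k\<close>.\<close>

lemma greedy_spread_ge:
  assumes k: "1 \<le> k" and S: "greedy_output V E p k S" and T: "T \<subseteq> V" "card T \<le> k"
  shows "\<sigma> S \<ge> (1 - 1 / exp 1) * \<sigma> T"
proof -
  have "S \<subseteq> V \<and> \<sigma> T - \<sigma> S \<le> (1 - 1 / real k) ^ card S * \<sigma> T" if "greedy_state V E p k S" for S
    using that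
  proof induction
    case start
    show ?case by simp
  next
    case (add S u)
    have u: "u \<in> V - S" "\<And>w. w \<in> V - S \<Longrightarrow> gain E p S w \<le> gain E p S u"
      using add.hyps(3) by (auto simp: is_arg_max_def not_less)
    have S: "S \<subseteq> V" "finite S" using add.IH finite_V finite_subset by auto
    have nonneg: "0 \<le> gain E p S u"
      unfolding gain_def using spread_mono[of S "S \<union> {u}"] S u by auto
    have "\<sigma> T \<le> \<sigma> (S \<union> T)" using spread_mono S T by simp
    then have "\<sigma> T - \<sigma> S \<le> (\<Sum>w\<in>T. gain E p S w)"
      using spread_Un_le_sum[OF S(1) T(1)] by linarith
    \<comment> \<open>Nodes of \<open>T\<close> already in \<open>S\<close> have gain 0, so the
      maximum over \<open>V - S\<close> bounds them too.\<close>
    also have "\<dots> \<le> (\<Sum>w\<in>T. gain E p S u)"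
    proof (rule sum_mono)
      fix w assume "w \<in> T"
      then show "gain E p S w \<le> gain E p S u"
        using u(2)[of w] T nonneg by (cases "w \<in> S") (auto simp: gain_def insert_absorb)
    qed
    also have "\<dots> \<le> real k * gain E p S u"
      using nonneg T by (simp add: mult_right_mono)
    finally have "\<sigma> T - \<sigma> (S \<union> {u}) \<le> (1 - 1 / real k) * (\<sigma> T - \<sigma> S)"
      using k by (simp add: gain_def field_simps)
    also have "\<dots> \<le> (1 - 1 / real k) * ((1 - 1 / real k) ^ card S * \<sigma> T)"
      using add.IH k by (intro mult_left_mono) auto
    finally show ?case using u S by simp
  qed
  then have "\<sigma> T - \<sigma> S \<le> (1 - 1 / real k) ^ card S * \<sigma> T" and "k \<le> card S"
    using S by (auto simp: greedy_output_def)
  moreover have "(1 - 1 / real k) ^ card S * \<sigma> T \<le> 1 / exp 1 * \<sigma> T"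
    using power_one_minus_inverse_le[OF k \<open>k \<le> card S\<close>] spread_mono[of "{}" T] T
    by (intro mult_right_mono) auto
  ultimately show ?thesis by (simp add: algebra_simps)
qed

section \<open>Adaptive greedy against a fixed seed set\<close>

lemma adaptive_greedy_is_policy: "adaptive_greedy V E p k \<pi> \<Longrightarrow> is_policy V E \<pi>"
  unfolding adaptive_greedy_def is_policy_def
  by (metis option.distinct(1) option.inject)

text \<open>The recursion of \<open>greedy_spread_ge\<close>, now for the mean cascade size
  \<open>a n\<close> of the seeds after \<open>n\<close> steps. Its step inequality is proved
  conditionally on the state and then averaged.\<close>

lemma adaptive_greedy_spread_ge:
  assumes k: "1 \<le> k" and \<pi>: "adaptive_greedy V E p k \<pi>" and T: "T \<subseteq> V" "card T \<le> k"
  shows "adaptive_spread E p \<pi> \<ge> (1 - 1 / exp 1) * \<sigma> T"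
proof -
  have pol: "is_policy V E \<pi>" using \<pi> by (rule adaptive_greedy_is_policy)
  define s where "s n \<phi> = run_state E \<pi> \<phi> n" for n \<phi>
  define a where "a n = measure_pmf.expectation P (\<lambda>\<phi>. cascade_size E (dom (s n \<phi>)) \<phi>)" for n
  have pr: "is_partial_realization V E (s n \<phi>)" for n \<phi>
    unfolding s_def run_state_def by (rule is_partial_realization_run[OF pol])
  have domV: "dom (s n \<phi>) \<subseteq> V" for n \<phi>
    unfolding s_def by (rule dom_run_state_subset_V[OF pol])
  have fin: "finite (dom (s n \<phi>))" for n \<phi>
    using domV finite_V finite_subset by blast
  have card: "card (dom (s n \<phi>)) \<le> n" for n \<phi>
  proof (induction n)
    case 0
    show ?case by (simp add: s_def)
  next
    case (Suc n)
    then show ?case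
      using fin[of n \<phi>] by (cases "\<pi> (s n \<phi>)") (auto simp: s_def dom_policy_step card_insert_if)
  qed
  have step: "\<sigma> T - a n \<le> real k * (a (Suc n) - a n)" if "n < k" for n
  proof -
    \<comment> \<open>The slack of the step inequality in a single realization; its mean over each
      fibre of \<open>s n\<close> is what is shown to be nonnegative.\<close>
    let ?h = "\<lambda>\<phi>. real k * (cascade_size E (dom (s (Suc n) \<phi>)) \<phi> - cascade_size E (dom (s n \<phi>)) \<phi>)
      - (cascade_size E T \<phi> - cascade_size E (dom (s n \<phi>)) \<phi>)"
    have "0 \<le> measure_pmf.expectation (cond_pmf P {\<phi>'. s n \<phi>' = s n \<phi>}) ?h"
      if \<phi>: "\<phi> \<in> set_pmf P" for \<phi>
    proof -
      define \<psi> where "\<psi> = s n \<phi>"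
      let ?C = "cond_pmf P {\<phi>'. consistent E \<phi>' \<psi>}"
      \<comment> \<open>Turns the fibre into the event on which \<open>cond_gain\<close>
        conditions.\<close>
      have cons: "{\<phi>'. s n \<phi>' = s n \<phi>} = {\<phi>'. consistent E \<phi>' \<psi>}"
        unfolding \<psi>_def s_def using run_state_consistent_cong[OF pol] consistent_run_state by metis
      have \<phi>_cons: "consistent E \<phi> \<psi>" unfolding \<psi>_def s_def by (rule consistent_run_state)
      then have ne: "set_pmf P \<inter> {\<phi>'. consistent E \<phi>' \<psi>} \<noteq> {}" using \<phi> by blast
      have setC: "set_pmf ?C = set_pmf P \<inter> {\<phi>'. consistent E \<phi>' \<psi>}"
        using ne by (rule set_cond_pmf)
      then have finC: "finite (set_pmf ?C)" by simp
      have intC: "integrable ?C f" for f :: "'a realization \<Rightarrow> real"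
        by (rule integrable_measure_pmf_finite[OF finC])
      \<comment> \<open>Positive probability is what makes the choice of
        \<open>adaptive_greedy\<close> at \<open>\<psi>\<close> a maximizer.\<close>
      have "measure_pmf.prob P {\<phi>'. consistent E \<phi>' \<psi>} > 0"
        using \<phi> \<phi>_cons by (intro measure_pmf_posI) auto
      moreover have "card (dom \<psi>) < k" using card[of n \<phi>] \<open>n < k\<close> by (simp add: \<psi>_def)
      ultimately obtain u where u: "\<pi> \<psi> = Some u" "u \<in> V - dom \<psi>"
        and max: "is_arg_max (cond_gain E p \<psi>) (\<lambda>w. w \<in> V - dom \<psi>) u"
        using \<pi> pr[of n \<phi>] unfolding adaptive_greedy_def \<psi>_def by metis
      have nonneg: "0 \<le> cond_gain E p \<psi> u"
        unfolding cond_gain_def using domV[of n \<phi>] u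
        by (intro Bochner_Integration.integral_nonneg) (auto simp: \<psi>_def intro!: cascade_size_mono)
      have le: "cond_gain E p \<psi> w \<le> cond_gain E p \<psi> u" if "w \<in> T" for w
      proof (cases "w \<in> dom \<psi>")
        case True
        then have "cond_gain E p \<psi> w = 0" by (simp add: cond_gain_def insert_absorb)
        then show ?thesis using nonneg by simp
      next
        case False
        then show ?thesis using max that T by (auto simp: is_arg_max_def not_less)
      qed
      have "measure_pmf.expectation ?C (\<lambda>\<phi>'. cascade_size E T \<phi>' - cascade_size E (dom \<psi>) \<phi>') \<le>
          measure_pmf.expectation ?C
            (\<lambda>\<phi>'. \<Sum>w\<in>T. cascade_size E (dom \<psi> \<union> {w}) \<phi>' - cascade_size E (dom \<psi>) \<phi>')"
      proof (rule expectation_mono_finite[OF finC])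
        fix \<phi>'
        have "dom \<psi> \<subseteq> V" using domV by (simp add: \<psi>_def)
        then show "cascade_size E T \<phi>' - cascade_size E (dom \<psi>) \<phi>' \<le>
            (\<Sum>w\<in>T. cascade_size E (dom \<psi> \<union> {w}) \<phi>' - cascade_size E (dom \<psi>) \<phi>')"
          using cascade_size_Un_le_sum[of "dom \<psi>" T \<phi>'] T
            cascade_size_mono[of T "dom \<psi> \<union> T" \<phi>'] by simp
      qed
      also have "\<dots> = (\<Sum>w\<in>T. cond_gain E p \<psi> w)"
        unfolding cond_gain_def by (rule Bochner_Integration.integral_sum) (rule intC)
      also have "\<dots> \<le> (\<Sum>w\<in>T. cond_gain E p \<psi> u)" by (rule sum_mono) (rule le)
      also have "\<dots> \<le> real k * cond_gain E p \<psi> u" using nonneg T by (simp add: mult_right_mono)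
      finally have "0 \<le> real k * cond_gain E p \<psi> u -
          measure_pmf.expectation ?C (\<lambda>\<phi>'. cascade_size E T \<phi>' - cascade_size E (dom \<psi>) \<phi>')"
        by simp
      also have "\<dots> = measure_pmf.expectation ?C
          (\<lambda>\<phi>'. real k * (cascade_size E (dom \<psi> \<union> {u}) \<phi>' - cascade_size E (dom \<psi>) \<phi>')
            - (cascade_size E T \<phi>' - cascade_size E (dom \<psi>) \<phi>'))"
        unfolding cond_gain_def by (simp add: intC)
      \<comment> \<open>All realizations in the fibre share the state \<open>\<psi>\<close> and
        hence the next seed \<open>u\<close>.\<close>
      also have "\<dots> = measure_pmf.expectation ?C ?h"
      proof (rule integral_cong_AE)
        show "AE \<phi>' in ?C. real k * (cascade_size E (dom \<psi> \<union> {u}) \<phi>' - cascade_size E (dom \<psi>) \<phi>')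
            - (cascade_size E T \<phi>' - cascade_size E (dom \<psi>) \<phi>') = ?h \<phi>'"
        proof (unfold AE_measure_pmf_iff, rule ballI)
          fix \<phi>' assume "\<phi>' \<in> set_pmf ?C"
          then have "s n \<phi>' = \<psi>" using setC cons by (auto simp: \<psi>_def)
          moreover from this have "dom (s (Suc n) \<phi>') = dom \<psi> \<union> {u}"
            using u by (simp add: s_def dom_policy_step)
          ultimately show "real k * (cascade_size E (dom \<psi> \<union> {u}) \<phi>' - cascade_size E (dom \<psi>) \<phi>')
            - (cascade_size E T \<phi>' - cascade_size E (dom \<psi>) \<phi>') = ?h \<phi>'" by simp
        qed
      qed simp_all
      finally show ?thesis unfolding cons .
    qed
    then have "0 \<le> measure_pmf.expectation P
        (\<lambda>\<phi>. measure_pmf.expectation (cond_pmf P {\<phi>'. s n \<phi>' = s n \<phi>}) ?h)"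
      by (intro integral_nonneg_AE) (simp add: AE_measure_pmf_iff)
    also have "\<dots> = measure_pmf.expectation P ?h"
      by (rule expectation_cond_fibre[symmetric]) simp
    also have "\<dots> = real k * (a (Suc n) - a n) - (\<sigma> T - a n)"
      by (simp add: a_def spread_def)
    finally show ?thesis by simp
  qed
  have "\<sigma> T - a n \<le> (1 - 1 / real k) ^ n * \<sigma> T" if "n \<le> k" for n
    using that
  proof (induction n)
    case 0
    show ?case by (simp add: a_def s_def cascade_size_def reached_def)
  next
    case (Suc n)
    have "\<sigma> T - a (Suc n) \<le> (1 - 1 / real k) * (\<sigma> T - a n)"
      using step[of n] Suc.prems k by (simp add: field_simps)
    also have "\<dots> \<le> (1 - 1 / real k) * ((1 - 1 / real k) ^ n * \<sigma> T)"
      using Suc k by (intro mult_left_mono) auto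
    finally show ?case by simp
  qed
  then have "\<sigma> T - a k \<le> (1 - 1 / real k) ^ k * \<sigma> T" by simp
  also have "\<dots> \<le> 1 / exp 1 * \<sigma> T"
    using power_one_minus_inverse_le[OF k order_refl] spread_mono[of "{}" T] T
    by (intro mult_right_mono) auto
  finally have "(1 - 1 / exp 1) * \<sigma> T \<le> a k" by (simp add: algebra_simps)
  also have "\<dots> \<le> adaptive_spread E p \<pi>"
    unfolding a_def adaptive_spread_def s_def
    by (intro expectation_mono_finite cascade_size_mono dom_run_state_subset_selected
        selected_subset[OF pol]) simp
  finally show ?thesis .
qed

text \<open>Common last step for both algorithms: \<open>adaptivity_gap\<close> with
  \<open>b = x / (1 - 1 / exp 1)\<close>, applied to an optimal policy.\<close>

lemma opt_adaptive_le:
  assumes "\<And>T. T \<subseteq> V \<Longrightarrow> card T \<le> k \<Longrightarrow> (1 - 1 / exp 1) * \<sigma> T \<le> x"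
  shows "1/4 * (1 - 1 / exp 1) * opt_adaptive V E p k \<le> x"
proof -
  obtain \<pi> where \<pi>: "\<pi> \<in> policies V E k" "opt_adaptive V E p k = adaptive_spread E p \<pi>"
    using opt_adaptive_attained[OF graph] by blast
  have c: "0 < 1 - 1 / exp (1 :: real)" by simp
  have "adaptive_spread E p \<pi> \<le> 4 * (x / (1 - 1 / exp 1))"
    by (rule adaptivity_gap[OF \<pi>(1)]) (use assms c in \<open>simp add: pos_le_divide_eq mult.commute\<close>)
  then have "(1 - 1 / exp 1) * adaptive_spread E p \<pi> \<le> 4 * x"
    using c by (simp add: pos_le_divide_eq mult.commute)
  then show ?thesis unfolding \<pi>(2) by linarith
qed

end

theorem theorem3:
  fixes V :: "'a set" and E :: "('a \<times> 'a) set" and p :: "'a \<times> 'a \<Rightarrow> real" and k :: nat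
  assumes "influence_graph V E p"
    and "1 \<le> k" and "k \<le> card V"
  shows "(\<forall>S. greedy_output V E p k S \<longrightarrow>
            spread E p S \<ge> 1/4 * (1 - 1 / exp 1) * opt_adaptive V E p k) \<and>
         (\<forall>\<pi>. adaptive_greedy V E p k \<pi> \<longrightarrow>
            adaptive_spread E p \<pi> \<ge> 1/4 * (1 - 1 / exp 1) * opt_adaptive V E p k)"
proof -
  interpret influence V E p by unfold_locales (rule assms(1))
  show ?thesis
    using opt_adaptive_le greedy_spread_ge[OF assms(2)] adaptive_greedy_spread_ge[OF assms(2)]
    by blast
qed

end
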